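(* Let $(A,\mathcal{L})$ be a polarized abelian surface over $\mathbb{C}$ of type $(1,d_2)$ with period matrix $(D\;Z)$, where $D=\mathrm{diag}(1,d_2)$ and $Z=\begin{pmatrix}\tau_1&\tau_2\\ \tau_2&\tau_3\end{pmatrix}\in\mathcal{H}_2$. Then $A$ contains an elliptic curve (as an abelian subvariety) if and only if there exists a vector $(a_{12},a_{13},a_{14},a_{23},a_{24},a_{34})\in\mathbb{Q}^6$ satisfying $$-d_2=d_2a_{13}+a_{24},$$ $$0=(\tau_1\tau_3-\tau_2^2)a_{12}-d_2a_{14}\tau_1+d_2a_{13}\tau_2-a_{24}\tau_2+a_{23}\tau_3+d_2a_{34},$$ $$0=a_{14}a_{23}-a_{13}a_{24}+a_{12}a_{34}.$$
   Context: $d_2$ is a positive integer. $\mathcal{H}_2$ is the Siegel upper half space of symmetric complex $2\times2$ matrices with positive definite imaginary part. That $(A,\mathcal{L})$ has period matrix $(D\;Z)$ means $A=V/\Lambda$ where, for suitable bases of the complex vector space $V$ and a symplectic basis of the lattice $\Lambda$ (for the polarization $\mathcal{L}$ of type $(1,d_2)$), the columns of $(D\;Z)$ are the coordinates of the lattice basis; i.e. $A\cong\mathbb{C}^2/(D\mathbb{Z}^2+Z\mathbb{Z}^2)$ with its standard polarization of type $(1,d_2)$. *)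

theory Defs
  imports "HOL-Complex_Analysis.Complex_Analysis" "HOL-Algebra.Coset"
begin

section \<open>Complex tori\<close>

definition lattice_basis :: "'v::euclidean_space set \<Rightarrow> 'v set \<Rightarrow> bool" where
  "lattice_basis L B \<longleftrightarrow>
     independent B \<and> span B = UNIV \<and> L = {\<Sum>b\<in>B. real_of_int (c b) *\<^sub>R b | c. True}"

definition full_lattice :: "'v::euclidean_space set \<Rightarrow> bool" where
  "full_lattice L \<longleftrightarrow> (\<exists>B. lattice_basis L B)"

definition additive_group :: "'v::ab_group_add monoid" where
  "additive_group = \<lparr>carrier = UNIV, mult = (+), one = 0\<rparr>"

definition torus :: "'v::ab_group_add set \<Rightarrow> 'v set monoid" where
  "torus L = additive_group Mod L"

definition torus_proj :: "'v::ab_group_add set \<Rightarrow> 'v \<Rightarrow> 'v set" where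
  "torus_proj L x = L #>\<^bsub>additive_group\<^esub> x"

text \<open>
  The complex structure of a torus \<open>V / L\<close> is the one for which the projection from \<open>V\<close> is locally
  biholomorphic. So a map of tori is a holomorphic immersion iff it is locally induced by a
  holomorphic immersion of the universal covers.
\<close>

definition holomorphic_immersion ::
    "complex set \<Rightarrow> (complex^2) set \<Rightarrow> (complex set \<Rightarrow> (complex^2) set) \<Rightarrow> bool" where
  "holomorphic_immersion M L \<phi> \<longleftrightarrow>
     (\<forall>z. \<exists>U f. open U \<and> z \<in> U \<and>
        (\<forall>i. (\<lambda>w. f w $ i) holomorphic_on U) \<and>
        (\<forall>w\<in>U. \<exists>i. deriv (\<lambda>w. f w $ i) w \<noteq> 0) \<and>
        (\<forall>w\<in>U. \<phi> (torus_proj M w) = torus_proj L (f w)))"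

text \<open>
  An elliptic curve over the complex numbers is a one-dimensional complex torus \<open>\<complex> / M\<close>. Since it
  is compact, an injective holomorphic immersion of it is a closed embedding. By Chow's theorem
  (GAGA), the images of the embeddings that are group homomorphisms are exactly the one-dimensional
  abelian subvarieties when the ambient torus is an abelian variety.
\<close>

definition elliptic_curve_in :: "(complex^2) set \<Rightarrow> (complex^2) set set \<Rightarrow> bool" where
  "elliptic_curve_in L C \<longleftrightarrow>
     (\<exists>M \<phi>. full_lattice M \<and>
        \<phi> \<in> hom (torus M) (torus L) \<and>
        inj_on \<phi> (carrier (torus M)) \<and>
        holomorphic_immersion M L \<phi> \<and>
        C = \<phi> ` carrier (torus M))"


section \<open>Polarizations and period matrices\<close>

text \<open>
  A polarization is given by the first Chern class of an ample line bundle: an alternating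
  real-bilinear form \<open>E\<close> of type (1,1), integral on the lattice and positive. The sign convention is
  that \<open>E(x, ix) > 0\<close>, i.e. \<open>E\<close> is a positive (1,1)-form. It is this sign that goes with
  a symplectic basis whose first half gives \<open>D\<close> and whose second half gives \<open>Z\<close> with \<open>Im Z > 0\<close>:
  for \<open>\<int> + \<tau>\<int>\<close> it gives \<open>E(1, \<tau>) = 1\<close>.
\<close>

definition polarization :: "(complex^2) set \<Rightarrow> (complex^2 \<Rightarrow> complex^2 \<Rightarrow> real) \<Rightarrow> bool" where
  "polarization L E \<longleftrightarrow>
     bilinear E \<and>
     (\<forall>x. E x x = 0) \<and>
     (\<forall>x y. E (\<i> *s x) (\<i> *s y) = E x y) \<and>
     (\<forall>x. x \<noteq> 0 \<longrightarrow> E x (\<i> *s x) > 0) \<and>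
     (\<forall>x\<in>L. \<forall>y\<in>L. E x y \<in> \<int>)"

text \<open>Every complex vector space of dimension two may be taken to be \<open>\<complex>\<^sup>2\<close>; \<open>L\<close> is arbitrary in it.\<close>

definition polarized_abelian_surface ::
    "(complex^2) set \<Rightarrow> (complex^2 \<Rightarrow> complex^2 \<Rightarrow> real) \<Rightarrow> bool" where
  "polarized_abelian_surface L E \<longleftrightarrow> full_lattice L \<and> polarization L E"

definition symplectic_basis ::
    "(complex^2) set \<Rightarrow> (complex^2 \<Rightarrow> complex^2 \<Rightarrow> real) \<Rightarrow> nat^2 \<Rightarrow>
     (2 \<Rightarrow> complex^2) \<Rightarrow> (2 \<Rightarrow> complex^2) \<Rightarrow> bool" where
  "symplectic_basis L E d l m \<longleftrightarrow>
     inj (case_sum l m) \<and>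
     lattice_basis L (range (case_sum l m)) \<and>
     (\<forall>i j. E (l i) (l j) = 0 \<and> E (m i) (m j) = 0 \<and>
            E (l i) (m j) = (if i = j then real (d $ i) else 0))"

definition has_type ::
    "(complex^2) set \<Rightarrow> (complex^2 \<Rightarrow> complex^2 \<Rightarrow> real) \<Rightarrow> nat^2 \<Rightarrow> bool" where
  "has_type L E d \<longleftrightarrow>
     0 < d $ 1 \<and> 0 < d $ 2 \<and> d $ 1 dvd d $ 2 \<and> (\<exists>l m. symplectic_basis L E d l m)"

definition diag_matrix :: "nat^2 \<Rightarrow> complex^2^2" where
  "diag_matrix d = (\<chi> i j. if i = j then of_nat (d $ i) else 0)"

definition complex_basis :: "(2 \<Rightarrow> complex^2) \<Rightarrow> bool" where
  "complex_basis e \<longleftrightarrow> inj e \<and> vec.independent (range e) \<and> vec.span (range e) = UNIV"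

text \<open>The columns of \<open>(D Z)\<close>, where \<open>D = diag_matrix d\<close>, are the coordinates of a symplectic basis.\<close>

definition has_period_matrix ::
    "(complex^2) set \<Rightarrow> (complex^2 \<Rightarrow> complex^2 \<Rightarrow> real) \<Rightarrow> nat^2 \<Rightarrow> complex^2^2 \<Rightarrow> bool" where
  "has_period_matrix L E d Z \<longleftrightarrow>
     (\<exists>e l m. complex_basis e \<and> symplectic_basis L E d l m \<and>
        (\<forall>j. l j = (\<Sum>i\<in>UNIV. diag_matrix d $ i $ j *s e i)) \<and>
        (\<forall>j. m j = (\<Sum>i\<in>UNIV. Z $ i $ j *s e i)))"

definition siegel_upper_half_space :: "(complex^2^2) set" where
  "siegel_upper_half_space =
     {Z. transpose Z = Z \<and> (\<forall>x::real^2. x \<noteq> 0 \<longrightarrow> x \<bullet> ((\<chi> i j. Im (Z $ i $ j)) *v x) > 0)}"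

end

theory Submission
  imports Defs
begin

text \<open>
  An elliptic curve in \<open>\<complex>\<^sup>2 / L\<close> is the image of a complex line \<open>\<complex> u\<close> that meets \<open>L\<close> in a lattice, that is,
  in two lattice vectors \<open>x\<close>, \<open>y\<close> dependent over \<open>\<complex>\<close> and independent over \<open>\<real>\<close>. The first dependence is
  a linear equation in the Plucker coordinates \<open>p\<^sub>i\<^sub>j\<close> of \<open>x \<and> y\<close>, whose coefficients are the minors of the
  period matrix. By positivity of the polarization, the independence means \<open>E x y \<noteq> 0\<close>, so the
  bivector can be rescaled rationally to \<open>E x y = d\<^sub>2\<close>. The three equations are therefore the
  normalization, the dependence, and the Plucker relation, with
  \<open>(a\<^sub>1\<^sub>2, a\<^sub>1\<^sub>3, a\<^sub>1\<^sub>4, a\<^sub>2\<^sub>3, a\<^sub>2\<^sub>4, a\<^sub>3\<^sub>4) = (p\<^sub>3\<^sub>4, - p\<^sub>2\<^sub>4, p\<^sub>2\<^sub>3, p\<^sub>1\<^sub>4, - p\<^sub>1\<^sub>3, p\<^sub>1\<^sub>2)\<close>.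
\<close>

lemma scaleR_eq_vector_scalar_mult: "r *\<^sub>R x = complex_of_real r *s x"
  unfolding vec_eq_iff by (simp add: scaleR_conv_of_real[where 'a = complex])

section \<open>Lattices as subgroups\<close>

lemma lattice_basis_mem:
  assumes "lattice_basis L B" "b \<in> B"
  shows "b \<in> L"
proof -
  have "finite B"
    using assms(1) by (auto simp: lattice_basis_def intro: independent_imp_finite)
  have "(\<Sum>a\<in>B. real_of_int (if a = b then 1 else 0) *\<^sub>R a) = (\<Sum>a\<in>B. if a = b then b else 0)"
    by (rule sum.cong) auto
  also have "\<dots> = b"
    using assms(2) \<open>finite B\<close> by simp
  finally have b: "(\<Sum>a\<in>B. real_of_int (if a = b then 1 else 0) *\<^sub>R a) = b" .
  have "L = {\<Sum>b\<in>B. real_of_int (c b) *\<^sub>R b | c. True}"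
    using assms(1) by (simp add: lattice_basis_def)
  then show ?thesis
    by (auto intro: exI[of _ "\<lambda>a. if a = b then 1 else 0"] simp only: b)
qed

lemma full_lattice_zero:
  assumes "full_lattice L" shows "0 \<in> L"
proof -
  obtain B where "L = {\<Sum>b\<in>B. real_of_int (c b) *\<^sub>R b | c. True}"
    using assms unfolding full_lattice_def lattice_basis_def by blast
  then show ?thesis by (auto intro!: exI[of _ "\<lambda>_. 0"])
qed

lemma full_lattice_diff:
  assumes "full_lattice L" "x \<in> L" "y \<in> L" shows "x - y \<in> L"
proof -
  obtain B where L: "L = {\<Sum>b\<in>B. real_of_int (c b) *\<^sub>R b | c. True}"
    using assms unfolding full_lattice_def lattice_basis_def by blast
  obtain c d where "x = (\<Sum>b\<in>B. real_of_int (c b) *\<^sub>R b)" "y = (\<Sum>b\<in>B. real_of_int (d b) *\<^sub>R b)"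
    using assms L by blast
  then have "x - y = (\<Sum>b\<in>B. real_of_int (c b - d b) *\<^sub>R b)"
    by (simp add: sum_subtractf scaleR_diff_left)
  then show ?thesis
    unfolding L by (intro CollectI exI[of _ "\<lambda>b. c b - d b"] conjI TrueI)
qed

lemma full_lattice_add:
  assumes "full_lattice L" "x \<in> L" "y \<in> L" shows "x + y \<in> L"
  using full_lattice_diff[OF assms(1,2) full_lattice_diff[OF assms(1) full_lattice_zero[OF assms(1)] assms(3)]]
  by simp

lemma comm_group_additive_group: "comm_group (additive_group :: 'v::ab_group_add monoid)"
proof (rule comm_groupI)
  fix x :: 'v
  show "\<exists>y\<in>carrier additive_group. y \<otimes>\<^bsub>additive_group\<^esub> x = \<one>\<^bsub>additive_group\<^esub>"
    by (rule bexI[of _ "- x"]) (auto simp: additive_group_def)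
qed (auto simp: additive_group_def algebra_simps)

lemma m_inv_additive_group: "inv\<^bsub>additive_group\<^esub> (x :: 'v::ab_group_add) = - x"
proof -
  interpret comm_group "additive_group :: 'v monoid" by (rule comm_group_additive_group)
  show ?thesis by (rule inv_equality) (auto simp: additive_group_def)
qed

lemma full_lattice_normal:
  assumes "full_lattice L" shows "L \<lhd> additive_group"
proof -
  interpret comm_group "additive_group :: 'a monoid" by (rule comm_group_additive_group)
  have "subgroup L additive_group"
  proof (rule subgroupI)
    show "L \<noteq> {}" using full_lattice_zero[OF assms] by blast
    show "inv\<^bsub>additive_group\<^esub> x \<in> L" if "x \<in> L" for x
      using full_lattice_diff[OF assms full_lattice_zero[OF assms] that]
      by (simp add: m_inv_additive_group)
  qed (use full_lattice_add[OF assms] in \<open>auto simp: additive_group_def\<close>)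
  then show ?thesis by (rule subgroup_imp_normal)
qed

lemma torus_proj_eq: "torus_proj L x = (\<lambda>l. l + x) ` L"
  by (auto simp: torus_proj_def r_coset_def additive_group_def)

lemma carrier_torus: "carrier (torus L) = range (torus_proj L)"
  by (auto simp: torus_def FactGroup_def RCOSETS_def torus_proj_def additive_group_def)

lemma torus_proj_eq_iff:
  assumes "full_lattice L"
  shows "torus_proj L x = torus_proj L y \<longleftrightarrow> x - y \<in> L"
proof
  assume "torus_proj L x = torus_proj L y"
  then have "0 + x \<in> torus_proj L y"
    using full_lattice_zero[OF assms] unfolding torus_proj_eq by blast
  then show "x - y \<in> L" by (auto simp: torus_proj_eq)
next
  assume xy: "x - y \<in> L"
  then have yx: "y - x \<in> L"
    using full_lattice_diff[OF assms full_lattice_zero[OF assms] xy] by simp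
  have "l + x = (l + (x - y)) + y" "l + y = (l + (y - x)) + x" for l by simp_all
  then show "torus_proj L x = torus_proj L y"
    unfolding torus_proj_eq using full_lattice_add[OF assms] xy yx by blast
qed

lemma torus_mult:
  assumes "full_lattice L"
  shows "torus_proj L x \<otimes>\<^bsub>torus L\<^esub> torus_proj L y = torus_proj L (x + y)"
proof -
  interpret normal L additive_group by (rule full_lattice_normal[OF assms])
  show ?thesis
    using rcos_sum[of x y] by (simp add: torus_def FactGroup_def torus_proj_def additive_group_def)
qed


lemma full_lattice_of_int_scale:
  assumes "full_lattice L" "x \<in> L" shows "real_of_int n *\<^sub>R x \<in> L"
proof -
  obtain B where L: "L = {\<Sum>b\<in>B. real_of_int (c b) *\<^sub>R b | c. True}"
    using assms unfolding full_lattice_def lattice_basis_def by blast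
  obtain c where "x = (\<Sum>b\<in>B. real_of_int (c b) *\<^sub>R b)"
    using assms L by blast
  then have "real_of_int n *\<^sub>R x = (\<Sum>b\<in>B. real_of_int (n * c b) *\<^sub>R b)"
    by (simp add: scaleR_sum_right)
  then show ?thesis
    unfolding L by (intro CollectI exI[of _ "\<lambda>b. n * c b"] conjI TrueI)
qed

section \<open>The polarization on complex lines\<close>

text \<open>The real part of \<open>c\<close> contributes a multiple of \<open>E x x = 0\<close>, so
  only the imaginary part survives.\<close>

lemma polarization_complex_scale:
  assumes "polarization L E"
  shows "E x (c *s x) = Im c * E x (\<i> *s x)"
proof -
  have bl: "bilinear E" and "E x x = 0"
    using assms by (auto simp: polarization_def)
  have "c = of_real (Re c) + of_real (Im c) * \<i>"
    by (simp add: complex_eq_iff)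
  then have "c *s x = Re c *\<^sub>R x + Im c *\<^sub>R (\<i> *s x)"
    unfolding scaleR_eq_vector_scalar_mult
    by (metis vec.scale_left_distrib vector_smult_assoc)
  then show ?thesis
    using \<open>E x x = 0\<close> by (simp add: bilinear_radd[OF bl] bilinear_rmul[OF bl])
qed

text \<open>Positivity makes \<open>E\<close> a test for real independence inside a complex line:
  this is how an integral value of \<open>E\<close> detects that two lattice vectors on the line
  span it over the reals.\<close>

lemma polarization_complex_scale_nonzero:
  assumes "polarization L E" "x \<noteq> 0"
  shows "E x (c *s x) \<noteq> 0 \<longleftrightarrow> Im c \<noteq> 0"
proof -
  have "E x (\<i> *s x) > 0"
    using assms by (simp add: polarization_def)
  then show ?thesis
    using polarization_complex_scale[OF assms(1), of x c] by simp
qed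

text \<open>The values of \<open>f\<close> on the subgroup \<open>H\<close> form a nonzero subgroup
  of the integers. Euclidean division by its least positive element, attained at \<open>w\<close>,
  leaves remainder zero.\<close>

lemma integral_linear_form_generator:
  fixes f :: "'v::real_vector \<Rightarrow> real"
  assumes lin: "linear f"
    and diff: "\<And>x y. x \<in> H \<Longrightarrow> y \<in> H \<Longrightarrow> x - y \<in> H"
    and scale: "\<And>(n::int) x. x \<in> H \<Longrightarrow> of_int n *\<^sub>R x \<in> H"
    and int: "\<And>x. x \<in> H \<Longrightarrow> f x \<in> \<int>"
    and ex: "x0 \<in> H" "f x0 \<noteq> 0"
  obtains w where "w \<in> H" "f w \<noteq> 0" "\<And>z. z \<in> H \<Longrightarrow> \<exists>n::int. f (z - of_int n *\<^sub>R w) = 0"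
proof -
  define P where "P k \<longleftrightarrow> 0 < k \<and> (\<exists>x\<in>H. f x = real k)" for k
  have "\<exists>k. P k"
  proof -
    obtain m where m: "f x0 = of_int m"
      using int[OF ex(1)] by (auto elim: Ints_cases)
    \<comment> \<open>Multiplying \<open>x0\<close> by the sign of its value produces a positive
      value.\<close>
    have "f (of_int (sgn m) *\<^sub>R x0) = of_int (sgn m * m)"
      by (simp add: linear_scale[OF lin] m)
    also have "sgn m * m = int (nat \<bar>m\<bar>)"
      by (simp add: sgn_if)
    finally have "f (of_int (sgn m) *\<^sub>R x0) = real (nat \<bar>m\<bar>)"
      by simp
    then show ?thesis
      unfolding P_def using scale[OF ex(1)] ex(2) m by (intro exI[of _ "nat \<bar>m\<bar>"]) auto
  qed
  then have "P (Least P)"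
    by (rule LeastI_ex)
  then obtain k w where k: "k = Least P" "0 < k" and w: "w \<in> H" "f w = real k"
    unfolding P_def by blast
  show ?thesis
  proof (rule that[OF w(1)])
    show "f w \<noteq> 0" using w k by simp
    fix z assume z: "z \<in> H"
    obtain m where m: "f z = of_int m"
      using int[OF z] by (auto elim: Ints_cases)
    let ?z = "z - of_int (m div int k) *\<^sub>R w"
    have zH: "?z \<in> H" by (intro diff scale z w)
    have "f ?z = of_int (m - (m div int k) * int k)"
      by (simp add: linear_diff[OF lin] linear_scale[OF lin] m w)
    also have "m - (m div int k) * int k = m mod int k"
      by (simp add: minus_div_mult_eq_mod)
    finally have fz: "f ?z = real (nat (m mod int k))"
      using k by simp
    have "nat (m mod int k) < k"
      using k by (simp add: nat_less_iff)
    then have "\<not> P (nat (m mod int k))"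
      using k not_less_Least by metis
    then have "nat (m mod int k) = 0"
      using fz zH unfolding P_def by (metis gr0I)
    then show "\<exists>n::int. f (z - of_int n *\<^sub>R w) = 0"
      using fz by (intro exI[of _ "m div int k"]) simp
  qed
qed

lemma linear_smult_left: "linear (\<lambda>z::complex. z *s (u::complex^'n))"
  by (rule linearI) (simp_all add: vec.scale_left_distrib vec_eq_iff)

text \<open>The pair is triangular: since \<open>w1\<close> is real and \<open>w2\<close> is not,
  \<open>Im z\<close> fixes the coefficient of \<open>w2\<close>, and \<open>Re z\<close> then fixes
  that of \<open>w1\<close>.\<close>

lemma lattice_basis_complexI:
  assumes w: "Im w1 = 0" "w1 \<noteq> 0" "Im w2 \<noteq> 0"
    and M: "\<And>z. z \<in> M \<longleftrightarrow> (\<exists>n1 n2. z = of_int n1 *\<^sub>R w1 + of_int n2 *\<^sub>R w2)"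
  shows "lattice_basis M {w1, w2}"
proof -
  have ne: "w1 \<noteq> w2" and Re: "Re w1 \<noteq> 0"
    using w by (auto simp: complex_eq_iff)
  have span: "z \<in> span {w1, w2}" for z
  proof -
    define b where "b = Im z / Im w2"
    define a where "a = (Re z - b * Re w2) / Re w1"
    have "z = a *\<^sub>R w1 + b *\<^sub>R w2"
      using w Re by (simp add: complex_eq_iff a_def b_def)
    then show ?thesis
      by (simp add: span_add span_mul span_base)
  qed
  \<comment> \<open>Two vectors that span a space of real dimension two are independent.\<close>
  have "independent {w1, w2}"
    by (rule card_le_dim_spanning[of _ UNIV]) (use span ne in auto)
  moreover have "M = {\<Sum>b\<in>{w1, w2}. real_of_int (c b) *\<^sub>R b | c. True}"
  proof safe
    fix z assume "z \<in> M"
    then obtain n1 n2 where "z = of_int n1 *\<^sub>R w1 + of_int n2 *\<^sub>R w2"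
      using M by blast
    then show "\<exists>c. z = (\<Sum>b\<in>{w1, w2}. real_of_int (c b) *\<^sub>R b) \<and> True"
      using ne by (intro exI[of _ "\<lambda>b. if b = w1 then n1 else n2"]) auto
  next
    fix c :: "complex \<Rightarrow> int"
    show "(\<Sum>b\<in>{w1, w2}. real_of_int (c b) *\<^sub>R b) \<in> M"
      using ne M by auto
  qed
  ultimately show ?thesis
    unfolding lattice_basis_def using span by blast
qed

text \<open>
  No discreteness is needed: \<open>z \<mapsto> E(u, z u)\<close> is integral on the group, and so is
  \<open>z \<mapsto> E(z u, w u)\<close> on the kernel of the first form.
\<close>

lemma full_lattice_complex_line:
  assumes L: "full_lattice L" and E: "polarization L E"
    and u: "u \<in> L" "u \<noteq> 0" and c: "Im c \<noteq> 0" "c *s u \<in> L"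
  shows "full_lattice {z. z *s u \<in> L}"
proof -
  define M where "M = {z. z *s u \<in> L}"
  have bl: "bilinear E" and Eint: "\<And>x y. x \<in> L \<Longrightarrow> y \<in> L \<Longrightarrow> E x y \<in> \<int>"
    using E by (auto simp: polarization_def)
  have diff: "x - y \<in> M" if "x \<in> M" "y \<in> M" for x y
    using that full_lattice_diff[OF L] by (simp add: M_def vec.scale_left_diff_distrib)
  have scale: "of_int n *\<^sub>R x \<in> M" if "x \<in> M" for n :: int and x
    using that full_lattice_of_int_scale[OF L, of "x *s u" n]
    by (simp add: M_def linear_scale[OF linear_smult_left])
  \<comment> \<open>\<open>f\<close> vanishes exactly on the real multipliers. It takes a nonzero
    value at \<open>c\<close>, so it yields the non-real generator \<open>w2\<close>.\<close>
  define f where "f z = E u (z *s u)" for z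
  have f: "linear f"
    using bl linear_compose[OF linear_smult_left, of "E u" u]
    unfolding bilinear_def f_def o_def by blast
  have f0: "f z = 0 \<longleftrightarrow> Im z = 0" for z
    using polarization_complex_scale_nonzero[OF E u(2)] by (auto simp: f_def)
  obtain w2 where w2: "w2 \<in> M" "f w2 \<noteq> 0"
    "\<And>z. z \<in> M \<Longrightarrow> \<exists>n::int. f (z - of_int n *\<^sub>R w2) = 0"
    by (rule integral_linear_form_generator[OF f diff scale, of c])
      (use c u f0 Eint in \<open>auto simp: M_def f_def\<close>)
  \<comment> \<open>\<open>K\<close> consists of the real multipliers in \<open>M\<close>. Pairing
    with \<open>w2 *s u\<close> is integral on \<open>K\<close> and nonzero at \<open>1\<close>,
    where it equals \<open>f w2\<close>; this yields the real generator \<open>w1\<close>.\<close>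
  define K where "K = {z \<in> M. f z = 0}"
  define g where "g z = E (z *s u) (w2 *s u)" for z
  have g: "linear g"
    using bl linear_compose[OF linear_smult_left, of "\<lambda>x. E x (w2 *s u)" u]
    unfolding bilinear_def g_def o_def by blast
  have g1: "g 1 = f w2" by (simp add: f_def g_def)
  have "1 \<in> K" using u f0 by (simp add: K_def M_def)
  obtain w1 where w1: "w1 \<in> K" "g w1 \<noteq> 0"
    "\<And>z. z \<in> K \<Longrightarrow> \<exists>n::int. g (z - of_int n *\<^sub>R w1) = 0"
  proof (rule integral_linear_form_generator[OF g, of K 1])
    show "g x \<in> \<int>" if "x \<in> K" for x
      using that w2(1) Eint by (auto simp: K_def M_def g_def)
  qed (use \<open>1 \<in> K\<close> g1 w2 diff scale in \<open>auto simp: K_def linear_diff[OF f] linear_scale[OF f]\<close>)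
  \<comment> \<open>The two forms together are injective: the first makes \<open>z\<close> real, and
    on reals \<open>g\<close> is multiplication by \<open>g 1\<close>.\<close>
  have zero: "z = 0" if "f z = 0" "g z = 0" for z
  proof -
    have "z = Re z *\<^sub>R 1" using that(1) f0 by (simp add: complex_eq_iff)
    then have "g z = Re z * g 1"
      by (metis linear_scale[OF g] real_scaleR_def)
    then have "Re z = 0" using that g1 w2(2) by simp
    then show ?thesis using that(1) f0 by (simp add: complex_eq_iff)
  qed
  have "lattice_basis M {w1, w2}"
  proof (rule lattice_basis_complexI)
    show "Im w1 = 0" "w1 \<noteq> 0" "Im w2 \<noteq> 0"
      using w1 w2 f0 linear_0[OF g] by (auto simp: K_def)
    fix z
    show "z \<in> M \<longleftrightarrow> (\<exists>n1 n2. z = of_int n1 *\<^sub>R w1 + of_int n2 *\<^sub>R w2)"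
    proof
      assume z: "z \<in> M"
      obtain n2 :: int where n2: "f (z - of_int n2 *\<^sub>R w2) = 0"
        using w2(3)[OF z] by blast
      then have K: "z - of_int n2 *\<^sub>R w2 \<in> K"
        using z w2(1) diff scale by (simp add: K_def)
      then obtain n1 :: int where n1: "g (z - of_int n2 *\<^sub>R w2 - of_int n1 *\<^sub>R w1) = 0"
        using w1(3) by blast
      have "f (z - of_int n2 *\<^sub>R w2 - of_int n1 *\<^sub>R w1) = 0"
        using n2 w1(1) by (simp add: linear_diff[OF f] linear_scale[OF f] K_def)
      then have "z - of_int n2 *\<^sub>R w2 - of_int n1 *\<^sub>R w1 = 0"
        using n1 zero by blast
      then show "\<exists>n1 n2. z = of_int n1 *\<^sub>R w1 + of_int n2 *\<^sub>R w2"
        by (intro exI[of _ n1] exI[of _ n2]) (simp add: algebra_simps)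
    next
      assume "\<exists>n1 n2. z = of_int n1 *\<^sub>R w1 + of_int n2 *\<^sub>R w2"
      \<comment> \<open>The sum is rewritten as a difference because closure of \<open>M\<close> is
        available as \<open>diff\<close>.\<close>
      then obtain n1 n2 :: int where z: "z = of_int n1 *\<^sub>R w1 - of_int (- n2) *\<^sub>R w2"
        by auto
      show "z \<in> M"
        unfolding z by (intro diff scale) (use w1 w2 in \<open>auto simp: K_def\<close>)
    qed
  qed
  then show ?thesis unfolding full_lattice_def M_def by blast
qed

section \<open>Elliptic curves as complex lines\<close>

text \<open>The multipliers form the full preimage of \<open>L\<close> under
  \<open>z \<mapsto> z *s u\<close>, so this map descends to an injective homomorphism of
  tori.\<close>

lemma elliptic_curve_in_complex_line:
  assumes L: "full_lattice L" and u: "u \<noteq> 0" and full: "full_lattice {z. z *s u \<in> L}"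
  shows "\<exists>C. elliptic_curve_in L C"
proof -
  define M where "M = {z. z *s u \<in> L}"
  have M: "full_lattice M" using full by (simp add: M_def)
  \<comment> \<open>Adding all of \<open>L\<close> to the image of the coset avoids choosing a
    representative.\<close>
  define \<phi> where "\<phi> X = {l + z *s u | l z. l \<in> L \<and> z \<in> X}" for X
  have \<phi>: "\<phi> (torus_proj M z) = torus_proj L (z *s u)" for z
  proof
    show "\<phi> (torus_proj M z) \<subseteq> torus_proj L (z *s u)"
    proof
      fix x assume "x \<in> \<phi> (torus_proj M z)"
      then obtain l m where "l \<in> L" "m *s u \<in> L" "x = l + (m + z) *s u"
        by (auto simp: \<phi>_def torus_proj_eq M_def)
      then have "l + m *s u \<in> L" "x = (l + m *s u) + z *s u"
        by (auto intro: full_lattice_add[OF L] simp: vec.scale_left_distrib)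
      then show "x \<in> torus_proj L (z *s u)"
        unfolding torus_proj_eq by blast
    qed
    have "z \<in> torus_proj M z"
      using full_lattice_zero[OF M] by (force simp: torus_proj_eq)
    then show "torus_proj L (z *s u) \<subseteq> \<phi> (torus_proj M z)"
      by (auto simp: \<phi>_def torus_proj_eq)
  qed
  have "\<phi> \<in> hom (torus M) (torus L)"
    by (auto simp: hom_def carrier_torus \<phi> torus_mult[OF M] torus_mult[OF L] vec.scale_left_distrib)
  moreover have "inj_on \<phi> (carrier (torus M))"
  proof (rule inj_onI)
    fix X Y assume "X \<in> carrier (torus M)" "Y \<in> carrier (torus M)" "\<phi> X = \<phi> Y"
    then obtain x y where "X = torus_proj M x" "Y = torus_proj M y" "x *s u - y *s u \<in> L"
      by (auto simp: carrier_torus \<phi> torus_proj_eq_iff[OF L])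
    then show "X = Y"
      by (simp add: torus_proj_eq_iff[OF M]) (simp add: M_def vec.scale_left_diff_distrib)
  qed
  moreover have "holomorphic_immersion M L \<phi>"
    unfolding holomorphic_immersion_def
  proof
    fix z :: complex
    obtain i where i: "u $ i \<noteq> 0" using u by (auto simp: vec_eq_iff)
    have "deriv (\<lambda>w. (w *s u) $ i) w = u $ i" for w
      by (rule DERIV_imp_deriv) (auto intro!: derivative_eq_intros)
    then show "\<exists>U f. open U \<and> z \<in> U \<and>
        (\<forall>i. (\<lambda>w. f w $ i) holomorphic_on U) \<and>
        (\<forall>w\<in>U. \<exists>i. deriv (\<lambda>w. f w $ i) w \<noteq> 0) \<and>
        (\<forall>w\<in>U. \<phi> (torus_proj M w) = torus_proj L (f w))"
      using i by (intro exI[of _ UNIV] exI[of _ "\<lambda>w. w *s u"])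
        (auto simp: \<phi> intro!: holomorphic_intros exI[of _ i])
  qed
  ultimately show ?thesis
    unfolding elliptic_curve_in_def using M by blast
qed

section \<open>Lifting holomorphic homomorphisms of tori to linear maps\<close>

text \<open>Discreteness enters only through the integrality of \<open>E(g w, v)\<close> for \<open>v\<close> in \<open>L\<close>.\<close>

lemma continuous_lattice_valued_constant:
  assumes L: "full_lattice L" and E: "polarization L E"
    and S: "connected S" "a \<in> S" "b \<in> S"
    and cont: "continuous_on S g" and mem: "\<And>w. w \<in> S \<Longrightarrow> g w \<in> L"
  shows "g a = g b"
proof -
  have bl: "bilinear E" and Eint: "\<And>x y. x \<in> L \<Longrightarrow> y \<in> L \<Longrightarrow> E x y \<in> \<int>"
    and pos: "\<And>x. x \<noteq> 0 \<Longrightarrow> E x (\<i> *s x) > 0"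
    using E by (auto simp: polarization_def)
  have orth: "E (g a - g b) v = 0" if v: "v \<in> L" for v
  proof -
    have lin: "linear (\<lambda>x. E x v)" using bl by (simp add: bilinear_def)
    have "(\<lambda>w. E (g w) v) constant_on S"
    proof (rule continuous_discrete_range_constant[OF S(1)])
      show "continuous_on S (\<lambda>w. E (g w) v)"
        using continuous_on_compose2[OF linear_continuous_on[OF lin[unfolded linear_conv_bounded_linear], of UNIV] cont]
        by simp
      fix x assume x: "x \<in> S"
      show "\<exists>e>0. \<forall>y. y \<in> S \<and> E (g y) v \<noteq> E (g x) v \<longrightarrow> e \<le> norm (E (g y) v - E (g x) v)"
      proof (intro exI[of _ 1] conjI allI impI)
        fix y assume y: "y \<in> S \<and> E (g y) v \<noteq> E (g x) v"
        have "E (g y) v - E (g x) v \<in> \<int>"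
          using x y v mem Eint by (intro Ints_diff) auto
        then show "1 \<le> norm (E (g y) v - E (g x) v)"
          using y Ints_nonzero_abs_ge1 by force
      qed simp
    qed
    then obtain k where "\<forall>w\<in>S. E (g w) v = k"
      unfolding constant_on_def by blast
    then show ?thesis
      using S by (simp add: bilinear_lsub[OF bl])
  qed
  \<comment> \<open>\<open>L\<close> spans the space over the reals, so \<open>g a - g b\<close> is
    orthogonal to every vector, in particular to its own multiple by \<open>\<i>\<close>. Positivity
    then makes it zero.\<close>
  obtain B where B: "lattice_basis L B" using L by (auto simp: full_lattice_def)
  have "E (g a - g b) x = 0" for x
  proof (rule linear_eq_0_on_span[of "E (g a - g b)" B])
    show "linear (E (g a - g b))" using bl unfolding bilinear_def by blast
  qed (use B orth lattice_basis_mem[OF B] in \<open>auto simp: lattice_basis_def\<close>)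
  then show ?thesis using pos[of "g a - g b"] by force
qed

text \<open>Near 0, translating the argument by \<open>v\<close> changes \<open>f\<close> only by a
  constant, so the derivative at \<open>v\<close> equals the derivative at 0.\<close>

lemma locally_affine_if_locally_additive:
  fixes f :: "complex \<Rightarrow> complex"
  assumes holo: "f holomorphic_on U" "open U" "ball 0 r \<subseteq> U" "r > 0"
    and add: "\<And>w w'. w \<in> ball 0 r \<Longrightarrow> w' \<in> ball 0 r \<Longrightarrow> f (w + w') = f w + f w' - f 0"
    and w: "w \<in> ball 0 r"
  shows "f w = f 0 + w * deriv f 0"
proof -
  have D0: "(f has_field_derivative deriv f 0) (at 0)"
    using holo by (intro holomorphic_derivI[of f U]) auto
  have D: "(f has_field_derivative deriv f 0) (at v)" if v: "v \<in> ball 0 r" for v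
  proof -
    have "((\<lambda>x. f x + (f v - f 0)) has_field_derivative deriv f 0) (at 0)"
      using D0 by (auto intro!: derivative_eq_intros)
    then have "((\<lambda>x. f (x + v)) has_field_derivative deriv f 0) (at 0)"
      by (rule has_field_derivative_transform_within_open[of _ _ _ "ball 0 r"])
        (use v holo(4) add in auto)
    then show ?thesis using DERIV_shift[of f "deriv f 0" 0 v] by simp
  qed
  have "\<exists>c. \<forall>x\<in>ball 0 r. f x - x * deriv f 0 = c"
  proof (rule has_field_derivative_zero_constant)
    fix x :: complex assume "x \<in> ball 0 r"
    then have "((\<lambda>x. f x - x * deriv f 0) has_field_derivative 0) (at x)"
      using D by (auto intro!: derivative_eq_intros)
    then show "((\<lambda>x. f x - x * deriv f 0) has_field_derivative 0) (at x within ball 0 r)"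
      by (rule has_field_derivative_at_within)
  qed simp
  then have "f w - w * deriv f 0 = f 0 - 0 * deriv f 0"
    using w holo(4) by (metis centre_in_ball)
  then show ?thesis by (simp add: algebra_simps)
qed

text \<open>A local lift at 0 is additive up to a constant, hence affine with slope
  \<open>u\<close>; the homomorphism property carries the formula from a small ball to the whole
  plane.\<close>

lemma holomorphic_hom_linear_lift:
  assumes L: "full_lattice L" and E: "polarization L E" and M: "full_lattice M"
    and hom: "\<phi> \<in> hom (torus M) (torus L)" and imm: "holomorphic_immersion M L \<phi>"
  obtains u where "u \<noteq> 0" "\<And>w. \<phi> (torus_proj M w) = torus_proj L (w *s u)"
proof -
  obtain U and f :: "complex \<Rightarrow> complex^2" where U: "open U" "0 \<in> U"
    and holo: "\<And>i. (\<lambda>w. f w $ i) holomorphic_on U"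
    and der: "\<exists>i. deriv (\<lambda>w. f w $ i) 0 \<noteq> 0"
    and \<phi>f: "\<And>w. w \<in> U \<Longrightarrow> \<phi> (torus_proj M w) = torus_proj L (f w)"
    using imm unfolding holomorphic_immersion_def by metis
  obtain r0 where "r0 > 0" "ball 0 r0 \<subseteq> U"
    using U open_contains_ball by blast
  \<comment> \<open>Half the radius keeps sums of two points of the ball inside
    \<open>U\<close>.\<close>
  define r where "r = r0 / 2"
  have r: "r > 0" "ball 0 r \<subseteq> U" using \<open>r0 > 0\<close> \<open>ball 0 r0 \<subseteq> U\<close> by (auto simp: r_def)
  have sumU: "w + w' \<in> U" if "w \<in> ball 0 r" "w' \<in> ball 0 r" for w w'
  proof -
    have "norm (w + w') < r0"
      using that norm_triangle_ineq[of w w'] by (simp add: r_def)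
    then show ?thesis using \<open>ball 0 r0 \<subseteq> U\<close> by auto
  qed
  have \<phi>add: "\<phi> (torus_proj M (w + w')) = \<phi> (torus_proj M w) \<otimes>\<^bsub>torus L\<^esub> \<phi> (torus_proj M w')" for w w'
    using hom by (auto simp: hom_def carrier_torus torus_mult[OF M, symmetric])
  have mem: "f (w + w') - f w - f w' \<in> L" if "w \<in> ball 0 r" "w' \<in> ball 0 r" for w w'
  proof -
    have "torus_proj L (f (w + w')) = torus_proj L (f w + f w')"
      using \<phi>add[of w w'] \<phi>f[OF sumU[OF that]] \<phi>f[of w] \<phi>f[of w'] that r(2)
      by (metis subsetD torus_mult[OF L])
    then show ?thesis by (simp add: torus_proj_eq_iff[OF L] diff_diff_eq)
  qed
  have "continuous_on U (\<lambda>w. \<chi> i. f w $ i)"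
    using holo by (intro continuous_on_vec_lambda holomorphic_on_imp_continuous_on)
  then have contf: "continuous_on U f" by simp
  have add: "f (w + w') = f w + f w' - f 0" if w: "w \<in> ball 0 r" "w' \<in> ball 0 r" for w w'
  proof -
    \<comment> \<open>The additivity defect is continuous in \<open>w\<close> with values in
      \<open>L\<close>, so it equals its value at \<open>w = 0\<close>, which is
      \<open>- f 0\<close>.\<close>
    have "f (w + w') - f w - f w' = f (0 + w') - f 0 - f w'"
    proof (rule continuous_lattice_valued_constant[OF L E, where S = "ball 0 r" and g = "\<lambda>w. f (w + w') - f w - f w'"])
      show "continuous_on (ball 0 r) (\<lambda>w. f (w + w') - f w - f w')"
        using r sumU w by (intro continuous_intros continuous_on_compose2[OF contf]) auto
    qed (use w r mem in auto)
    then show ?thesis by (simp add: algebra_simps)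
  qed
  define u where "u = (\<chi> i. deriv (\<lambda>w. f w $ i) 0)"
  have "u \<noteq> 0" using der by (auto simp: u_def vec_eq_iff)
  have flin: "f w = f 0 + w *s u" if "w \<in> ball 0 r" for w
    unfolding vec_eq_iff
  proof
    fix i
    have "f w $ i = f 0 $ i + w * deriv (\<lambda>w. f w $ i) 0"
      by (rule locally_affine_if_locally_additive[OF holo U(1) r(2,1) _ that]) (simp add: add)
    then show "f w $ i = (f 0 + w *s u) $ i" by (simp add: u_def)
  qed
  \<comment> \<open>The defect at the pair \<open>(0, 0)\<close> is \<open>- f 0\<close>; hence the
    constant term disappears modulo \<open>L\<close>.\<close>
  have "f 0 \<in> L"
  proof -
    have "0 - f 0 \<in> L" using mem[of 0 0] r(1) by simp
    from full_lattice_diff[OF L full_lattice_zero[OF L] this] show ?thesis by simp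
  qed
  have loc: "\<phi> (torus_proj M w) = torus_proj L (w *s u)" if "w \<in> ball 0 r" for w
  proof -
    have "\<phi> (torus_proj M w) = torus_proj L (f w)"
      using that r(2) by (intro \<phi>f) blast
    then show ?thesis
      using flin[OF that] \<open>f 0 \<in> L\<close> by (simp add: torus_proj_eq_iff[OF L])
  qed
  \<comment> \<open>Every point of the plane is a natural multiple of a point of the ball, namely
    \<open>n\<close> times \<open>w / n\<close> for large \<open>n\<close>.\<close>
  have mult: "\<phi> (torus_proj M (of_nat n * w)) = torus_proj L ((of_nat n * w) *s u)" if "w \<in> ball 0 r" for n w
  proof (induction n)
    case 0
    then show ?case using loc[of 0] r by simp
  next
    case (Suc n)
    have "\<phi> (torus_proj M (of_nat (Suc n) * w)) = \<phi> (torus_proj M (of_nat n * w + w))"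
      by (simp add: algebra_simps)
    also have "\<dots> = torus_proj L ((of_nat n * w) *s u + w *s u)"
      unfolding \<phi>add Suc loc[OF that] torus_mult[OF L] ..
    also have "(of_nat n * w) *s u + w *s u = (of_nat (Suc n) * w) *s u"
      by (simp add: vec_eq_iff algebra_simps)
    finally show ?case .
  qed
  have "\<phi> (torus_proj M w) = torus_proj L (w *s u)" for w
  proof -
    obtain n :: nat where n: "norm w / r < real n" using reals_Archimedean2 by blast
    moreover have "0 \<le> norm w / r" using r by simp
    ultimately have "0 < n" by linarith
    then have "w / of_nat n \<in> ball 0 r"
      using n r by (simp add: norm_divide field_simps)
    from mult[OF this, of n] show ?thesis using \<open>0 < n\<close> by simp
  qed
  with \<open>u \<noteq> 0\<close> show ?thesis by (rule that)
qed

text \<open>A lattice basis has two elements, the real dimension of the plane, and a real ratio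
  would make them dependent.\<close>

lemma full_lattice_complex_basis:
  assumes "full_lattice (M :: complex set)"
  obtains m1 m2 where "m1 \<in> M" "m2 \<in> M" "m1 \<noteq> 0" "Im (m2 / m1) \<noteq> 0"
proof -
  obtain B where B: "lattice_basis M B" using assms by (auto simp: full_lattice_def)
  then have ind: "independent B" and span: "span B = UNIV" by (auto simp: lattice_basis_def)
  have "card B = 2"
    using dim_eq_card[OF _ ind, of UNIV] span by simp
  then obtain m1 m2 where m: "B = {m1, m2}" "m1 \<noteq> m2" by (auto simp: card_2_iff)
  have "m1 \<noteq> 0" using ind m dependent_zero by blast
  have "Im (m2 / m1) \<noteq> 0"
  proof
    assume "Im (m2 / m1) = 0"
    then have "m2 / m1 = of_real (Re (m2 / m1))" by (simp add: complex_eq_iff)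
    then have "m2 = Re (m2 / m1) *\<^sub>R m1"
      using \<open>m1 \<noteq> 0\<close> by (metis nonzero_eq_divide_eq scaleR_conv_of_real)
    then have "m2 \<in> span {m1}" by (metis span_base span_mul singletonI)
    moreover have "{m1} = B - {m2}" using m by auto
    ultimately show False using ind m by (auto simp: dependent_def)
  qed
  then show ?thesis using that[of m1 m2] lattice_basis_mem[OF B] m \<open>m1 \<noteq> 0\<close> by auto
qed

text \<open>Forward, the linear lift sends \<open>M\<close> into \<open>L\<close>, so a basis of
  \<open>M\<close> gives two lattice vectors on one complex line with non-real ratio. Backward, the
  line through \<open>x\<close> meets \<open>L\<close> in a lattice and thus carries an elliptic
  curve.\<close>

proposition elliptic_curve_in_iff_complex_line:
  assumes L: "full_lattice L" and E: "polarization L E"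
  shows "(\<exists>C. elliptic_curve_in L C) \<longleftrightarrow> (\<exists>x\<in>L. \<exists>c. x \<noteq> 0 \<and> Im c \<noteq> 0 \<and> c *s x \<in> L)"
proof
  assume "\<exists>C. elliptic_curve_in L C"
  then obtain M \<phi> where M: "full_lattice M"
    and \<phi>: "\<phi> \<in> hom (torus M) (torus L)" "holomorphic_immersion M L \<phi>"
    by (auto simp: elliptic_curve_in_def)
  obtain u where u: "u \<noteq> 0" "\<And>w. \<phi> (torus_proj M w) = torus_proj L (w *s u)"
    using holomorphic_hom_linear_lift[OF L E M \<phi>] by blast
  have mem: "m *s u \<in> L" if "m \<in> M" for m
  proof -
    have "torus_proj M m = torus_proj M 0" using that by (simp add: torus_proj_eq_iff[OF M])
    then have "torus_proj L (m *s u) = torus_proj L (0 *s u)" using u(2) by metis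
    then show ?thesis by (simp add: torus_proj_eq_iff[OF L])
  qed
  obtain m1 m2 where m: "m1 \<in> M" "m2 \<in> M" "m1 \<noteq> 0" "Im (m2 / m1) \<noteq> 0"
    using full_lattice_complex_basis[OF M] by blast
  show "\<exists>x\<in>L. \<exists>c. x \<noteq> 0 \<and> Im c \<noteq> 0 \<and> c *s x \<in> L"
    using m u(1) mem by (intro bexI[of _ "m1 *s u"] exI[of _ "m2 / m1"]) auto
next
  assume "\<exists>x\<in>L. \<exists>c. x \<noteq> 0 \<and> Im c \<noteq> 0 \<and> c *s x \<in> L"
  then show "\<exists>C. elliptic_curve_in L C"
    using full_lattice_complex_line[OF L E] elliptic_curve_in_complex_line[OF L] by blast
qed

section \<open>Plucker coordinates\<close>

text \<open>Two rows of the alternating matrix \<open>(p\<^sub>i\<^sub>j)\<close> through a nonzero entry span the plane of the bivector.\<close>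

lemma decomposable_integer_bivector:
  fixes p12 p13 p14 p23 p24 p34 :: int
  assumes "p12 * p34 - p13 * p24 + p14 * p23 = 0" "p13 \<noteq> 0 \<or> p24 \<noteq> 0"
  obtains k x1 x2 x3 x4 y1 y2 y3 y4 where "k \<noteq> 0"
    "x1 * y2 - x2 * y1 = k * p12" "x1 * y3 - x3 * y1 = k * p13" "x1 * y4 - x4 * y1 = k * p14"
    "x2 * y3 - x3 * y2 = k * p23" "x2 * y4 - x4 * y2 = k * p24" "x3 * y4 - x4 * y3 = k * p34"
  using assms(2)
proof
  \<comment> \<open>The instantiation follows the order of occurrence
    \<open>k, x1, y2, x2, y1, y3, x3, y4, x4\<close>. It gives rows 1 and 3,
    \<open>x = (0, p12, p13, p14)\<close> and \<open>y = (- p13, - p23, 0, p34)\<close>; the Plucker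
    relation is what yields the minor \<open>k * p24\<close>.\<close>
  assume "p13 \<noteq> 0"
  then show ?thesis
    by (rule that[of p13 0 "- p23" p12 "- p13" 0 p13 p34 p14])
      (use assms(1) in \<open>simp_all add: algebra_simps\<close>)
next
  \<comment> \<open>Rows 2 and 4, in the same order of instantiation; here the relation yields the
    minor \<open>k * p13\<close>.\<close>
  assume "p24 \<noteq> 0"
  then show ?thesis
    by (rule that[of p24 "- p12" "- p24" 0 "- p14" "- p34" p23 0 p24])
      (use assms(1) in \<open>simp_all add: algebra_simps\<close>)
qed

lemma rat_common_denominator:
  fixes S :: "rat set"
  assumes "finite S"
  obtains N :: int where "N > 0" "\<And>q. q \<in> S \<Longrightarrow> \<exists>b. of_int N * q = of_int b"
  using assms
proof (induction S arbitrary: thesis)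
  case empty
  then show ?case by (meson empty_iff zero_less_one)
next
  case (insert a S)
  obtain N :: int where N: "N > 0" "\<And>q. q \<in> S \<Longrightarrow> \<exists>b. of_int N * q = of_int b"
    using insert.IH by blast
  obtain s t :: int where a: "a = of_int s / of_int t" "t > 0"
    using quotient_of_div quotient_of_denom_pos by (metis surj_pair)
  show ?case
  proof (rule insert.prems[of "N * t"])
    show "N * t > 0" using N a by simp
    fix q assume "q \<in> insert a S"
    then consider "q = a" | "q \<in> S" by blast
    then show "\<exists>b. of_int (N * t) * q = of_int b"
    proof cases
      case 1
      then show ?thesis using a by (intro exI[of _ "N * s"]) simp
    next
      case 2
      then obtain b where "of_int N * q = of_int b" using N(2) by blast
      then show ?thesis by (intro exI[of _ "t * b"]) (simp add: mult_ac)
    qed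
  qed
qed

section \<open>Lattice vectors in period coordinates\<close>

lemma symplectic_basis_mem_iff:
  assumes "symplectic_basis L E d l m"
  shows "x \<in> L \<longleftrightarrow> (\<exists>x1 x2 x3 x4. x = real_of_int x1 *\<^sub>R l 1 + real_of_int x2 *\<^sub>R l 2
    + real_of_int x3 *\<^sub>R m 1 + real_of_int x4 *\<^sub>R m 2)"
proof -
  let ?b = "case_sum l m"
  have inj: "inj ?b" and L: "L = {\<Sum>b\<in>range ?b. real_of_int (c b) *\<^sub>R b | c. True}"
    using assms by (auto simp: symplectic_basis_def lattice_basis_def)
  have sum: "(\<Sum>b\<in>range ?b. real_of_int (c b) *\<^sub>R b) =
      real_of_int (c (l 1)) *\<^sub>R l 1 + real_of_int (c (l 2)) *\<^sub>R l 2
      + real_of_int (c (m 1)) *\<^sub>R m 1 + real_of_int (c (m 2)) *\<^sub>R m 2" for c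
  proof -
    have "(\<Sum>b\<in>range ?b. real_of_int (c b) *\<^sub>R b) = (\<Sum>s\<in>UNIV <+> UNIV. real_of_int (c (?b s)) *\<^sub>R ?b s)"
      using inj by (simp add: sum.reindex)
    also have "\<dots> = (\<Sum>i\<in>UNIV. real_of_int (c (l i)) *\<^sub>R l i) + (\<Sum>i\<in>UNIV. real_of_int (c (m i)) *\<^sub>R m i)"
      by (subst sum.Plus) auto
    finally show ?thesis by (simp add: sum_2)
  qed
  show ?thesis
  proof
    assume "x \<in> L"
    then show "\<exists>x1 x2 x3 x4. x = real_of_int x1 *\<^sub>R l 1 + real_of_int x2 *\<^sub>R l 2
        + real_of_int x3 *\<^sub>R m 1 + real_of_int x4 *\<^sub>R m 2"
      unfolding L sum by blast
  next
    assume "\<exists>x1 x2 x3 x4. x = real_of_int x1 *\<^sub>R l 1 + real_of_int x2 *\<^sub>R l 2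
        + real_of_int x3 *\<^sub>R m 1 + real_of_int x4 *\<^sub>R m 2"
    then obtain x1 x2 x3 x4 where x: "x = real_of_int x1 *\<^sub>R l 1 + real_of_int x2 *\<^sub>R l 2
        + real_of_int x3 *\<^sub>R m 1 + real_of_int x4 *\<^sub>R m 2" by blast
    \<comment> \<open>Coefficients of a lattice basis are indexed by vectors, so they are
      transported along the inverse of the injective indexing.\<close>
    define c where "c b = case_sum (\<lambda>i. if i = 1 then x1 else x2) (\<lambda>i. if i = 1 then x3 else x4) (inv_into UNIV ?b b)" for b
    have "c (l i) = (if i = 1 then x1 else x2)" "c (m i) = (if i = 1 then x3 else x4)" for i
      using inv_f_f[OF inj, of "Inl i"] inv_f_f[OF inj, of "Inr i"] by (simp_all add: c_def)
    then have "x = (\<Sum>b\<in>range ?b. real_of_int (c b) *\<^sub>R b)"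
      unfolding sum x by simp
    then show "x \<in> L" unfolding L by blast
  qed
qed

lemma complex_basis_eq_iff:
  assumes "complex_basis e"
  shows "a *s e 1 + b *s e 2 = a' *s e 1 + b' *s e 2 \<longleftrightarrow> a = a' \<and> b = b'"
proof
  assume eq: "a *s e 1 + b *s e 2 = a' *s e 1 + b' *s e 2"
  have "(1::2) \<noteq> 2" by simp
  then have ind: "vec.independent (range e)" and ne: "e 1 \<noteq> e 2"
    using assms by (auto simp: complex_basis_def dest: injD)
  define k where "k v = (if v = e 1 then a - a' else b - b')" for v
  have "(\<Sum>v\<in>{e 1, e 2}. k v *s v) = (a - a') *s e 1 + (b - b') *s e 2"
    using ne by (simp add: k_def)
  also have "\<dots> = 0"
    using eq by (simp add: vec.scale_left_diff_distrib algebra_simps)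
  finally have "k v = 0" if "v \<in> {e 1, e 2}" for v
    using that vec.independentD[OF ind, of "{e 1, e 2}" k v] by blast
  from this[of "e 1"] this[of "e 2"] show "a = a' \<and> b = b'"
    using ne by (simp add: k_def)
qed simp

lemma proportional_pairs:
  fixes a b a' b' :: "'a::field"
  assumes "a * b' = b * a'" "a \<noteq> 0 \<or> b \<noteq> 0"
  obtains c where "a' = c * a" "b' = c * b"
proof (cases "a = 0")
  case True
  then show ?thesis using assms by (intro that[of "b' / b"]) auto
next
  case False
  then show ?thesis using assms(1) by (intro that[of "a' / a"]) (auto simp: field_simps)
qed

text \<open>The first condition is the vanishing of the determinant of two lattice vectors in the
  basis \<open>e\<close>, that is, their complex dependence. The second says that \<open>E\<close>
  is nonzero on them, which makes the first vector nonzero and the ratio non-real.\<close>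

lemma complex_line_iff_integer_vectors:
  fixes d2 :: nat
  assumes E: "polarization L E" and sb: "symplectic_basis L E (vector [1, d2]) l m"
    and e: "complex_basis e"
    and l: "l 1 = e 1" "l 2 = of_nat d2 *s e 2"
    and m: "m 1 = \<tau>1 *s e 1 + \<tau>2 *s e 2" "m 2 = \<tau>2 *s e 1 + \<tau>3 *s e 2"
  shows "(\<exists>x\<in>L. \<exists>c. x \<noteq> 0 \<and> Im c \<noteq> 0 \<and> c *s x \<in> L) \<longleftrightarrow>
    (\<exists>x1 x2 x3 x4 y1 y2 y3 y4 :: int.
       (of_int x1 + of_int x3 * \<tau>1 + of_int x4 * \<tau>2) * (of_nat d2 * of_int y2 + of_int y3 * \<tau>2 + of_int y4 * \<tau>3)
       = (of_nat d2 * of_int x2 + of_int x3 * \<tau>2 + of_int x4 * \<tau>3) * (of_int y1 + of_int y3 * \<tau>1 + of_int y4 * \<tau>2)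
     \<and> (x1 * y3 - x3 * y1) + int d2 * (x2 * y4 - x4 * y2) \<noteq> 0)"
    (is "?lhs \<longleftrightarrow> (\<exists>x1 x2 x3 x4 y1 y2 y3 y4. ?A x1 x3 x4 * ?B y2 y3 y4 = ?B x2 x3 x4 * ?A y1 y3 y4 \<and> ?Q x1 x2 x3 x4 y1 y2 y3 y4 \<noteq> 0)")
proof -
  have bl: "bilinear E" using E by (simp add: polarization_def)
  define v where "v x1 x2 x3 x4 = real_of_int x1 *\<^sub>R l 1 + real_of_int x2 *\<^sub>R l 2
    + real_of_int x3 *\<^sub>R m 1 + real_of_int x4 *\<^sub>R m 2" for x1 x2 x3 x4
  \<comment> \<open>\<open>?A\<close> and \<open>?B\<close> are the two rows of the period matrix
    applied to the integer coordinates.\<close>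
  have v: "v x1 x2 x3 x4 = ?A x1 x3 x4 *s e 1 + ?B x2 x3 x4 *s e 2" for x1 x2 x3 x4
    unfolding v_def l m scaleR_eq_vector_scalar_mult by (simp add: vec_eq_iff algebra_simps)
  have mem: "x \<in> L \<longleftrightarrow> (\<exists>x1 x2 x3 x4. x = v x1 x2 x3 x4)" for x
    unfolding v_def by (rule symplectic_basis_mem_iff[OF sb])
  have Ev: "E (v x1 x2 x3 x4) (v y1 y2 y3 y4) = of_int (?Q x1 x2 x3 x4 y1 y2 y3 y4)" for x1 x2 x3 x4 y1 y2 y3 y4
  proof -
    have Elm: "E (l i) (l j) = 0" "E (m i) (m j) = 0"
      "E (l i) (m j) = (if i = j then real (vector [1, d2] $ i) else 0)" for i j
      using sb by (auto simp: symplectic_basis_def)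
    have "E x y = - E y x" for x y
    proof -
      have "E (x + y) (x + y) = 0" "E x x = 0" "E y y = 0" using E by (auto simp: polarization_def)
      then show ?thesis by (simp add: bilinear_ladd[OF bl] bilinear_radd[OF bl])
    qed
    then have Eml: "E (m i) (l j) = - E (l j) (m i)" for i j .
    show ?thesis
      unfolding v_def
      by (simp add: bilinear_ladd[OF bl] bilinear_radd[OF bl] bilinear_lmul[OF bl] bilinear_rmul[OF bl]
          Eml Elm vector_2 algebra_simps)
  qed
  show ?thesis
  proof
    assume ?lhs
    then obtain x c where x: "x \<in> L" "x \<noteq> 0" and c: "Im c \<noteq> 0" "c *s x \<in> L" by blast
    obtain x1 x2 x3 x4 where xv: "x = v x1 x2 x3 x4" using x mem by blast
    obtain y1 y2 y3 y4 where yv: "c *s x = v y1 y2 y3 y4" using c mem by blast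
    have "(c * ?A x1 x3 x4) *s e 1 + (c * ?B x2 x3 x4) *s e 2 = ?A y1 y3 y4 *s e 1 + ?B y2 y3 y4 *s e 2"
      using yv unfolding xv v by (simp add: vec_eq_iff algebra_simps)
    then have eqs: "c * ?A x1 x3 x4 = ?A y1 y3 y4" "c * ?B x2 x3 x4 = ?B y2 y3 y4"
      unfolding complex_basis_eq_iff[OF e] by blast+
    have "?A x1 x3 x4 * ?B y2 y3 y4 = ?B x2 x3 x4 * ?A y1 y3 y4"
      unfolding eqs[symmetric] by (simp only: mult_ac)
    moreover have "E x (c *s x) \<noteq> 0"
      using polarization_complex_scale_nonzero[OF E x(2)] c(1) by blast
    then have "?Q x1 x2 x3 x4 y1 y2 y3 y4 \<noteq> 0"
      unfolding yv unfolding xv Ev of_int_eq_0_iff .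
    ultimately show "\<exists>x1 x2 x3 x4 y1 y2 y3 y4. ?A x1 x3 x4 * ?B y2 y3 y4 = ?B x2 x3 x4 * ?A y1 y3 y4
      \<and> ?Q x1 x2 x3 x4 y1 y2 y3 y4 \<noteq> 0"
      by blast
  next
    assume "\<exists>x1 x2 x3 x4 y1 y2 y3 y4. ?A x1 x3 x4 * ?B y2 y3 y4 = ?B x2 x3 x4 * ?A y1 y3 y4
      \<and> ?Q x1 x2 x3 x4 y1 y2 y3 y4 \<noteq> 0"
    then obtain x1 x2 x3 x4 y1 y2 y3 y4
      where det: "?A x1 x3 x4 * ?B y2 y3 y4 = ?B x2 x3 x4 * ?A y1 y3 y4"
        and Q: "?Q x1 x2 x3 x4 y1 y2 y3 y4 \<noteq> 0" by blast
    define x y where "x = v x1 x2 x3 x4" and "y = v y1 y2 y3 y4"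
    have xy: "x \<in> L" "y \<in> L" using mem by (auto simp: x_def y_def)
    have Exy: "E x y \<noteq> 0" using Q unfolding x_def y_def Ev of_int_eq_0_iff .
    then have x0: "x \<noteq> 0" using bilinear_lzero[OF bl, of y] by auto
    have "?A x1 x3 x4 \<noteq> 0 \<or> ?B x2 x3 x4 \<noteq> 0"
    proof (rule ccontr)
      assume "\<not> (?A x1 x3 x4 \<noteq> 0 \<or> ?B x2 x3 x4 \<noteq> 0)"
      then have "?A x1 x3 x4 = 0" "?B x2 x3 x4 = 0" by blast+
      then have "x = 0" by (simp only: x_def v) simp
      with x0 show False by blast
    qed
    then obtain c where "?A y1 y3 y4 = c * ?A x1 x3 x4" "?B y2 y3 y4 = c * ?B x2 x3 x4"
      using proportional_pairs[OF det] by blast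
    then have "y = c *s x"
      by (simp only: x_def y_def v vec.scale_right_distrib vector_smult_assoc)
    then show ?lhs
      using polarization_complex_scale_nonzero[OF E x0, of c] Exy x0 xy by auto
  qed
qed

text \<open>The determinant and the value of \<open>E\<close> depend only on the minors of the two
  integer vectors, and linearly. Rescaling the bivector thus normalizes one way, and clearing
  denominators returns to integers.\<close>

lemma integer_vectors_iff_rational_bivector:
  fixes \<tau>1 \<tau>2 \<tau>3 :: complex
  assumes "d2 > 0"
  shows "(\<exists>x1 x2 x3 x4 y1 y2 y3 y4 :: int.
       (of_int x1 + of_int x3 * \<tau>1 + of_int x4 * \<tau>2) * (of_nat d2 * of_int y2 + of_int y3 * \<tau>2 + of_int y4 * \<tau>3)
       = (of_nat d2 * of_int x2 + of_int x3 * \<tau>2 + of_int x4 * \<tau>3) * (of_int y1 + of_int y3 * \<tau>1 + of_int y4 * \<tau>2)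
     \<and> (x1 * y3 - x3 * y1) + int d2 * (x2 * y4 - x4 * y2) \<noteq> 0) \<longleftrightarrow>
    (\<exists>a12 a13 a14 a23 a24 a34 :: rat.
        - of_nat d2 = of_nat d2 * a13 + a24 \<and>
        0 = (\<tau>1 * \<tau>3 - \<tau>2\<^sup>2) * of_rat a12 - of_nat d2 * of_rat a14 * \<tau>1
            + of_nat d2 * of_rat a13 * \<tau>2 - of_rat a24 * \<tau>2
            + of_rat a23 * \<tau>3 + of_nat d2 * of_rat a34 \<and>
        0 = a14 * a23 - a13 * a24 + a12 * a34)"
    (is "?lhs \<longleftrightarrow> ?rhs")
proof
  assume ?lhs
  then obtain x1 x2 x3 x4 y1 y2 y3 y4 :: int
    where det: "(of_int x1 + of_int x3 * \<tau>1 + of_int x4 * \<tau>2) * (of_nat d2 * of_int y2 + of_int y3 * \<tau>2 + of_int y4 * \<tau>3)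
       = (of_nat d2 * of_int x2 + of_int x3 * \<tau>2 + of_int x4 * \<tau>3) * (of_int y1 + of_int y3 * \<tau>1 + of_int y4 * \<tau>2)"
      and Q: "(x1 * y3 - x3 * y1) + int d2 * (x2 * y4 - x4 * y2) \<noteq> 0" by blast
  define q where "q = (x1 * y3 - x3 * y1) + int d2 * (x2 * y4 - x4 * y2)"
  \<comment> \<open>\<open>q\<close> is the value of \<open>E\<close> on the two vectors, and
    \<open>s\<close> rescales it to \<open>d2\<close>. The existential witnesses are fixed by the
    equations shown below: the minors times \<open>s\<close>, with negative sign for
    \<open>a13\<close> and \<open>a24\<close>.\<close>
  define s :: rat where "s = of_nat d2 / of_int q"
  have s: "s * of_int q = of_nat d2" using Q unfolding s_def q_def[symmetric] by simp
  show ?rhs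
  proof (intro exI conjI)
    show "- of_nat d2 = of_nat d2 * (- s * of_int (x2 * y4 - x4 * y2)) + (- s * of_int (x1 * y3 - x3 * y1))"
      using s unfolding q_def by (simp add: algebra_simps)
    show "0 = (\<tau>1 * \<tau>3 - \<tau>2\<^sup>2) * of_rat (s * of_int (x3 * y4 - x4 * y3))
        - of_nat d2 * of_rat (s * of_int (x2 * y3 - x3 * y2)) * \<tau>1
        + of_nat d2 * of_rat (- s * of_int (x2 * y4 - x4 * y2)) * \<tau>2
        - of_rat (- s * of_int (x1 * y3 - x3 * y1)) * \<tau>2
        + of_rat (s * of_int (x1 * y4 - x4 * y1)) * \<tau>3 + of_nat d2 * of_rat (s * of_int (x1 * y2 - x2 * y1))"
      (is "0 = ?R")
    proof -
      have "?R = of_rat s * ((of_int x1 + of_int x3 * \<tau>1 + of_int x4 * \<tau>2) * (of_nat d2 * of_int y2 + of_int y3 * \<tau>2 + of_int y4 * \<tau>3)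
       - (of_nat d2 * of_int x2 + of_int x3 * \<tau>2 + of_int x4 * \<tau>3) * (of_int y1 + of_int y3 * \<tau>1 + of_int y4 * \<tau>2))"
        by (simp add: of_rat_mult of_rat_minus of_rat_diff algebra_simps power2_eq_square)
      then show ?thesis using det by simp
    qed
    show "0 = (s * of_int (x2 * y3 - x3 * y2)) * (s * of_int (x1 * y4 - x4 * y1))
        - (- s * of_int (x2 * y4 - x4 * y2)) * (- s * of_int (x1 * y3 - x3 * y1))
        + (s * of_int (x3 * y4 - x4 * y3)) * (s * of_int (x1 * y2 - x2 * y1))"
      by (simp add: algebra_simps)
  qed
next
  assume ?rhs
  then obtain a12 a13 a14 a23 a24 a34 :: rat
    where a: "- of_nat d2 = of_nat d2 * a13 + a24"
      "0 = (\<tau>1 * \<tau>3 - \<tau>2\<^sup>2) * of_rat a12 - of_nat d2 * of_rat a14 * \<tau>1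
            + of_nat d2 * of_rat a13 * \<tau>2 - of_rat a24 * \<tau>2
            + of_rat a23 * \<tau>3 + of_nat d2 * of_rat a34"
      "0 = a14 * a23 - a13 * a24 + a12 * a34" by blast
  obtain N :: int where N: "N > 0"
    and "\<And>q. q \<in> {a12, a13, a14, a23, a24, a34} \<Longrightarrow> \<exists>b. of_int N * q = of_int b"
    using rat_common_denominator[of "{a12, a13, a14, a23, a24, a34}"] by blast
  then obtain b12 b13 b14 b23 b24 b34 :: int
    where "of_int N * a12 = of_int b12" "of_int N * a13 = of_int b13" "of_int N * a14 = of_int b14"
      "of_int N * a23 = of_int b23" "of_int N * a24 = of_int b24" "of_int N * a34 = of_int b34"
    by (meson insertCI)
  then have b: "of_int b12 = of_int N * a12" "of_int b13 = of_int N * a13" "of_int b14 = of_int N * a14"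
      "of_int b23 = of_int N * a23" "of_int b24 = of_int N * a24" "of_int b34 = of_int N * a34"
    by simp_all
  \<comment> \<open>Transports the cleared denominators from the rationals to the complex
    equation.\<close>
  have cb: "of_int b = (of_int N * of_rat a :: complex)" if "of_int b = of_int N * a" for b a
    using that by (metis of_rat_mult of_rat_of_int_eq)
  have "(of_int (b14 * b23 - b13 * b24 + b12 * b34) :: rat) = of_int N * of_int N * (a14 * a23 - a13 * a24 + a12 * a34)"
    by (simp add: b algebra_simps)
  then have pl: "b14 * b23 - b13 * b24 + b12 * b34 = 0"
    using a(3) by (metis mult_zero_right of_int_eq_0_iff)
  have "(of_int (int d2 * b13 + b24) :: rat) = of_int N * (of_nat d2 * a13 + a24)"
    by (simp add: b algebra_simps)
  also have "\<dots> = of_int (- (N * int d2))"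
    unfolding a(1)[symmetric] by simp
  finally have q: "int d2 * b13 + b24 = - (N * int d2)"
    by (simp only: of_int_eq_iff)
  \<comment> \<open>The normalization, multiplied by \<open>N\<close>, prevents
    \<open>p13 = - b24\<close> and \<open>p24 = - b13\<close> from vanishing together, as
    decomposing the bivector requires.\<close>
  then have "int d2 * b13 + b24 \<noteq> 0" using N assms by simp
  then have "- b24 \<noteq> 0 \<or> - b13 \<noteq> 0" by auto
  moreover have "b34 * b12 - (- b24) * (- b13) + b23 * b14 = 0"
    using pl by (simp add: algebra_simps)
  ultimately obtain k x1 x2 x3 x4 y1 y2 y3 y4 where k: "k \<noteq> 0"
    and p: "x1 * y2 - x2 * y1 = k * b34" "x1 * y3 - x3 * y1 = k * - b24" "x1 * y4 - x4 * y1 = k * b23"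
    "x2 * y3 - x3 * y2 = k * b14" "x2 * y4 - x4 * y2 = k * - b13" "x3 * y4 - x4 * y3 = k * b12"
    using decomposable_integer_bivector[of b34 b12 "- b24" "- b13" b23 b14] by metis
  have cp: "of_int x * of_int y - of_int z * of_int w = (of_int p :: complex)" if "x * y - z * w = p" for x y z w p
    using that by (metis of_int_diff of_int_mult)
  \<comment> \<open>Cauchy-Binet expansion: the determinant is a combination of the minors of the
    integer vectors with the minors of the period matrix as coefficients.\<close>
  have "(of_int x1 + of_int x3 * \<tau>1 + of_int x4 * \<tau>2) * (of_nat d2 * of_int y2 + of_int y3 * \<tau>2 + of_int y4 * \<tau>3)
       - (of_nat d2 * of_int x2 + of_int x3 * \<tau>2 + of_int x4 * \<tau>3) * (of_int y1 + of_int y3 * \<tau>1 + of_int y4 * \<tau>2)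
     = (\<tau>1 * \<tau>3 - \<tau>2\<^sup>2) * (of_int x3 * of_int y4 - of_int x4 * of_int y3)
        - of_nat d2 * (of_int x2 * of_int y3 - of_int x3 * of_int y2) * \<tau>1
        - of_nat d2 * (of_int x2 * of_int y4 - of_int x4 * of_int y2) * \<tau>2
        + (of_int x1 * of_int y3 - of_int x3 * of_int y1) * \<tau>2
        + (of_int x1 * of_int y4 - of_int x4 * of_int y1) * \<tau>3
        + of_nat d2 * (of_int x1 * of_int y2 - of_int x2 * of_int y1)"
    by (simp add: algebra_simps power2_eq_square)
  also have "\<dots> = of_int k * of_int N * ((\<tau>1 * \<tau>3 - \<tau>2\<^sup>2) * of_rat a12 - of_nat d2 * of_rat a14 * \<tau>1
            + of_nat d2 * of_rat a13 * \<tau>2 - of_rat a24 * \<tau>2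
            + of_rat a23 * \<tau>3 + of_nat d2 * of_rat a34)"
    unfolding p[THEN cp] of_int_mult of_int_minus b[THEN cb] by (simp add: algebra_simps)
  also have "\<dots> = 0" unfolding a(2)[symmetric] by simp
  finally have det: "(of_int x1 + of_int x3 * \<tau>1 + of_int x4 * \<tau>2) * (of_nat d2 * of_int y2 + of_int y3 * \<tau>2 + of_int y4 * \<tau>3)
       = (of_nat d2 * of_int x2 + of_int x3 * \<tau>2 + of_int x4 * \<tau>3) * (of_int y1 + of_int y3 * \<tau>1 + of_int y4 * \<tau>2)"
    by simp
  have "(x1 * y3 - x3 * y1) + int d2 * (x2 * y4 - x4 * y2) = - k * (int d2 * b13 + b24)"
    unfolding p by (simp add: algebra_simps)
  then have "(x1 * y3 - x3 * y1) + int d2 * (x2 * y4 - x4 * y2) \<noteq> 0"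
    using k \<open>int d2 * b13 + b24 \<noteq> 0\<close> by simp
  with det show ?lhs by blast
qed

theorem proposition4p4:
  fixes L :: "(complex^2) set"
    and E :: "complex^2 \<Rightarrow> complex^2 \<Rightarrow> real"
    and d2 :: nat
    and \<tau>1 \<tau>2 \<tau>3 :: complex
    and Z :: "complex^2^2"
  assumes "d2 > 0"
    and "polarized_abelian_surface L E"
    and "has_type L E (vector [1, d2])"
    and "Z = vector [vector [\<tau>1, \<tau>2], vector [\<tau>2, \<tau>3]]"
    and "Z \<in> siegel_upper_half_space"
    and "has_period_matrix L E (vector [1, d2]) Z"
  shows "(\<exists>C. elliptic_curve_in L C) \<longleftrightarrow>
    (\<exists>a12 a13 a14 a23 a24 a34 :: rat.
        - of_nat d2 = of_nat d2 * a13 + a24 \<and>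
        0 = (\<tau>1 * \<tau>3 - \<tau>2\<^sup>2) * of_rat a12 - of_nat d2 * of_rat a14 * \<tau>1
            + of_nat d2 * of_rat a13 * \<tau>2 - of_rat a24 * \<tau>2
            + of_rat a23 * \<tau>3 + of_nat d2 * of_rat a34 \<and>
        0 = a14 * a23 - a13 * a24 + a12 * a34)"
proof -
  have L: "full_lattice L" and E: "polarization L E"
    using assms(2) by (auto simp: polarized_abelian_surface_def)
  obtain e l m where e: "complex_basis e" and sb: "symplectic_basis L E (vector [1, d2]) l m"
    and l: "\<And>j. l j = (\<Sum>i\<in>UNIV. diag_matrix (vector [1, d2]) $ i $ j *s e i)"
    and m: "\<And>j. m j = (\<Sum>i\<in>UNIV. Z $ i $ j *s e i)"
    using assms(6) unfolding has_period_matrix_def by blast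
  \<comment> \<open>The columns of the period matrix written out in the basis
    \<open>e\<close>.\<close>
  have "l 1 = e 1" "l 2 = of_nat d2 *s e 2"
    "m 1 = \<tau>1 *s e 1 + \<tau>2 *s e 2" "m 2 = \<tau>2 *s e 1 + \<tau>3 *s e 2"
    by (simp_all add: l m sum_2 diag_matrix_def assms(4) vector_2)
  from complex_line_iff_integer_vectors[OF E sb e this] show ?thesis
    unfolding elliptic_curve_in_iff_complex_line[OF L E]
      integer_vectors_iff_rational_bivector[OF assms(1), symmetric] .
qed

end
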